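(* Let $f:\mathcal{X}\to\mathbb{R}$ be differentiable and closed (all sublevel sets $\{\mathbf{x}\in\mathcal{X}: f(\mathbf{x})\le a\}$, $a\in\mathbb{R}$, are closed) on its open domain $\mathcal{X}$, and suppose $f\in\mathcal{F}_{\ell}(\|\cdot\|)$. Then for every $\mathbf{x}\in\mathcal{X}$, $$\|\nabla f(\mathbf{x})\|_*^2\le 2\,\ell(2\|\nabla f(\mathbf{x})\|_* )\,(f(\mathbf{x})-f^* ).$$
   Context: $\mathcal{E}$ is a finite-dimensional real Banach space with norm $\|\cdot\|$, dual space $\mathcal{E}^*$ and dual norm $\|\mathbf{u}\|_*:=\sup\{\langle\mathbf{u},\mathbf{y}\rangle:\|\mathbf{y}\|\le1\}$; $\mathcal{X}\subseteq\mathcal{E}$. $f^*=f(\mathbf{x}_* )$ where $\mathbf{x}_*\in\operatorname{argmin}_{\mathbf{x}\in\mathcal{X}}f(\mathbf{x})$ (assumed to exist). $\ell*$-smoothness: for a non-decreasing continuous $\ell:\mathbb{R}_+\to\mathbb{R}_{++}$ ($\mathbb{R}_+$ nonnegative, $\mathbb{R}_{++}$ positive reals), a differentiable $f:\mathcal{X}\to\mathbb{R}$ belongs to $\mathcal{F}_\ell(\|\cdot\|)$ if for almost every $\mathbf{x}\in\mathcal{X}$: $\|\nabla^2f(\mathbf{x})\mathbf{h}\|_*\le\ell(\|\nabla f(\mathbf{x})\|_* )\|\mathbf{h}\|$ for all $\mathbf{h}\in\mathcal{X}$.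
   Formalization: The gradient is additionally assumed locally Lipschitz on the domain (a primitive of the extended Cantor function refutes the claim otherwise), and the Hessian bound is required for all directions h in the whole space E, not only h in X (otherwise the claim fails on small balls far from 0). *)

theory Defs
  imports "HOL-Analysis.Analysis"
begin

text \<open>The dual space of a normed space is the library type \<^typ>\<open>'a \<Rightarrow>\<^sub>L real\<close>; the dual norm,
  defined as a supremum over the unit ball, coincides with the norm of that type.\<close>

definition dual_norm :: "('a::real_normed_vector \<Rightarrow>\<^sub>L real) \<Rightarrow> real" where
  "dual_norm u = Sup {blinfun_apply u y |y. norm y \<le> 1}"

lemma dual_norm_eq_norm: "dual_norm u = norm u"
  unfolding dual_norm_def
proof (rule cSup_eq_non_empty)
  show "{blinfun_apply u y |y. norm y \<le> 1} \<noteq> {}"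
    using norm_zero by (auto intro!: exI[of _ 0])
  fix r assume "r \<in> {blinfun_apply u y |y. norm y \<le> 1}"
  then obtain y where y: "r = blinfun_apply u y" "norm y \<le> 1" by auto
  have "r \<le> norm (blinfun_apply u y)" by (simp add: y)
  also have "\<dots> \<le> norm u * norm y" by (rule norm_blinfun)
  also have "\<dots> \<le> norm u" using y(2) by (simp add: mult_left_le)
  finally show "r \<le> norm u" .
next
  fix s assume s: "\<And>r. r \<in> {blinfun_apply u y |y. norm y \<le> 1} \<Longrightarrow> r \<le> s"
  have s': "blinfun_apply u y \<le> s" if "norm y \<le> 1" for y
    using s that by blast
  have "0 \<le> s" using s'[of 0] by simp
  then show "norm u \<le> s"
  proof (rule norm_blinfun_bound)
    fix x
    show "norm (blinfun_apply u x) \<le> s * norm x"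
    proof (cases "x = 0")
      case False
      have "blinfun_apply u (x /\<^sub>R norm x) \<le> s" "blinfun_apply u (- (x /\<^sub>R norm x)) \<le> s"
        using False by (auto intro!: s')
      with False show ?thesis
        by (simp add: blinfun.scaleR_right blinfun.minus_right field_simps abs_le_iff)
    qed simp
  qed
qed

text \<open>The gradient is the Frechet derivative viewed as an element of the dual space. It is used
  only at points of an open domain, where it is determined by the values of \<open>f\<close> on the domain.
  Accordingly the Hessian at \<open>x\<close> is the derivative of \<^term>\<open>grad f\<close> at \<open>x\<close>, a linear map into
  the dual space.\<close>

definition grad :: "('a::real_normed_vector \<Rightarrow> real) \<Rightarrow> 'a \<Rightarrow> 'a \<Rightarrow>\<^sub>L real" where
  "grad f x = Blinfun (frechet_derivative f (at x))"

definition hess :: "('a::real_normed_vector \<Rightarrow> real) \<Rightarrow> 'a \<Rightarrow> 'a \<Rightarrow> 'a \<Rightarrow>\<^sub>L real" where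
  "hess f x = frechet_derivative (grad f) (at x)"

definition finite_dimensional :: "'a::real_vector itself \<Rightarrow> bool" where
  "finite_dimensional _ \<longleftrightarrow> (\<exists>B::'a set. finite B \<and> span B = UNIV)"

text \<open>Almost everywhere with respect to Lebesgue measure on a finite-dimensional space without a
  distinguished basis: Lebesgue measure is transported along the coordinates of a basis. Null sets
  do not depend on the basis, so quantifying over some or over every basis is the same.\<close>

definition almost_everywhere :: "('a::real_vector \<Rightarrow> bool) \<Rightarrow> bool" where
  "almost_everywhere P \<longleftrightarrow>
     (\<exists>B. finite B \<and> independent B \<and> span B = UNIV \<and>
          (AE c in (\<Pi>\<^sub>M b\<in>B. (lborel :: real measure)). P (\<Sum>b\<in>B. c b *\<^sub>R b)))"

text \<open>The class of \<open>\<ell>*\<close>-smooth functions on an open set \<open>X\<close>. The Hessian bound is a statement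
  about the operator norm of the Hessian, hence about all directions \<open>h\<close> of the ambient space.

  For the a.e. defined Hessian to control \<open>f\<close>, the class consists of functions whose gradient is
  locally Lipschitz on \<open>X\<close> (so that the Hessian exists a.e. by Rademacher's theorem). Local
  Lipschitz continuity does not follow from the pointwise a.e. bound alone: a primitive of the
  Cantor staircase, extended to the real line by \<open>c (x + 1) = c x + 1\<close>, has second derivative
  \<open>0\<close> almost everywhere.\<close>

definition ell_smooth ::
    "(real \<Rightarrow> real) \<Rightarrow> 'a::real_normed_vector set \<Rightarrow> ('a \<Rightarrow> real) \<Rightarrow> bool" where
  "ell_smooth \<l> X f \<longleftrightarrow>
     f differentiable_on X \<and>
     (\<forall>x\<in>X. \<exists>e>0. \<exists>L. L-lipschitz_on (ball x e \<inter> X) (grad f)) \<and>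
     almost_everywhere (\<lambda>x. x \<in> X \<longrightarrow>
       grad f differentiable (at x) \<and>
       (\<forall>h. dual_norm (hess f x h) \<le> \<l> (dual_norm (grad f x)) * norm h))"

end

theory Submission imports Defs begin

text \<open>Walk from \<open>x\<close> along \<open>x - t *\<^sub>R h\<close> with \<open>norm h \<le> 1\<close> and \<open>a = grad f x h > 0\<close>, up to
  \<open>t = a / L\<close> where \<open>L = \<l> (2 * norm (grad f x))\<close>. As long as the gradient has norm below
  \<open>2 * norm (grad f x)\<close>, it is locally \<open>L\<close>-Lipschitz, hence differs from \<open>grad f x\<close> by at most
  \<open>L * t < norm (grad f x)\<close>, so the bound persists. Meanwhile \<open>f\<close> is at most
  \<open>f x - a * t + L * t\<^sup>2 / 2 \<le> f x\<close>, and closedness of the sublevel set keeps the walk inside the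
  domain. At \<open>t = a / L\<close> the decrease is \<open>a\<^sup>2 / (2 * L)\<close>; take the supremum over \<open>h\<close>.

  The a.e. Hessian bound says nothing about a single segment, but by Fubini and translation
  invariance it holds a.e. on arbitrarily small translates of any given segment, and the Lipschitz
  bound passes to the limit by continuity.\<close>

section \<open>Mean value inequality for Lipschitz curves\<close>

text \<open>Cover the exceptional null set by an open \<open>W\<close> of measure below \<epsilon>.
  Short intervals around a good point obey the rate \<open>K + \<epsilon>\<close>; those around an
  exceptional point lie in \<open>W\<close>, where the Lipschitz constant is charged to the measure
  of \<open>W\<close>. Bisection adds these estimates up, with total charge at most
  \<open>L * \<epsilon>\<close>. No derivative is integrated, so the codomain need not be
  complete.\<close>

lemma norm_diff_le_of_AE_derivative:
  fixes \<phi> :: "real \<Rightarrow> 'b::real_normed_vector"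
  assumes "a \<le> b" and "0 \<le> K" and lip: "L-lipschitz_on {a..b} \<phi>"
    and ae: "AE t in lborel. t \<in> {a..b} \<longrightarrow>
      (\<exists>D. (\<phi> has_vector_derivative D) (at t) \<and> norm D \<le> K)"
  shows "norm (\<phi> b - \<phi> a) \<le> K * (b - a)"
proof -
  obtain N where N: "N \<in> null_sets lborel"
    and good: "\<And>t. t \<in> {a..b} \<Longrightarrow> t \<notin> N \<Longrightarrow>
      \<exists>D. (\<phi> has_vector_derivative D) (at t) \<and> norm D \<le> K"
    by (rule AE_E3[OF ae]) auto
  have L: "0 \<le> L" using lip by (rule lipschitz_on_nonneg)
  have bound: "norm (\<phi> b - \<phi> a) \<le> (K + \<epsilon>) * (b - a) + L * \<epsilon>" if "\<epsilon> > 0" for \<epsilon>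
  proof -
    obtain W where W: "open W" "N \<subseteq> W" "emeasure lborel (W - N) < ennreal \<epsilon>"
      using outer_regular_lborel[OF _ \<open>\<epsilon> > 0\<close>, of N] null_setsD2[OF N] by auto
    have "emeasure lborel W = emeasure lborel (W - N)"
      using N W by (simp add: emeasure_Diff_null_set)
    then have emW: "emeasure lborel W < ennreal \<epsilon>" using W by simp
    have W_fm: "A \<in> fmeasurable lborel" if "A \<subseteq> W" "A \<in> sets borel" for A
      using that emW emeasure_mono[of A W lborel] W(1)
      by (intro fmeasurableI) (auto simp: less_top[symmetric] top_unique)
    define m where "m u v = measure lborel (W \<inter> {u..v})" for u v
    have "m a b \<le> measure lborel W"
      unfolding m_def using W(1) by (intro measure_mono_fmeasurable W_fm) auto
    moreover have "measure lborel W \<le> \<epsilon>"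
      using emW \<open>\<epsilon> > 0\<close> by (simp add: measure_def enn2real_leI less_imp_le)
    ultimately have mab: "m a b \<le> \<epsilon>" by simp
    \<comment> \<open>The guard makes \<open>P\<close> vacuous on intervals that leave
      \<open>{a..b}\<close>: Bolzano's local condition ranges over all short intervals around a
      point, but \<phi> is controlled only on \<open>{a..b}\<close>.\<close>
    define P where "P u v \<longleftrightarrow> (a \<le> u \<and> v \<le> b \<and> u \<le> v \<longrightarrow>
        norm (\<phi> v - \<phi> u) \<le> (K + \<epsilon>) * (v - u) + L * m u v)" for u v
    have "P a b"
      using \<open>a \<le> b\<close>
    proof (induction rule: Bolzano)
      case (trans u v w)
      show ?case
        unfolding P_def
      proof
        assume uw: "a \<le> u \<and> w \<le> b \<and> u \<le> w"
        have "m u v + m v w = m u w"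
        proof -
          have "m u w = measure lborel ((W \<inter> {u..v}) \<union> (W \<inter> {v..w} - {v}))"
            unfolding m_def using trans(3,4) by (intro arg_cong[where f="measure lborel"]) auto
          also have "\<dots> = m u v + measure lborel (W \<inter> {v..w} - {v})"
            unfolding m_def using W(1) by (intro measure_Un_AE)
              (auto intro!: W_fm AE_I2)
          also have "measure lborel (W \<inter> {v..w} - {v}) = m v w"
            unfolding m_def using W(1) by (intro measure_Diff_null_set) auto
          finally show ?thesis by simp
        qed
        moreover have "norm (\<phi> v - \<phi> u) \<le> (K + \<epsilon>) * (v - u) + L * m u v"
          "norm (\<phi> w - \<phi> v) \<le> (K + \<epsilon>) * (w - v) + L * m v w"
          using trans uw unfolding P_def by auto
        moreover have "norm (\<phi> w - \<phi> u) \<le> norm (\<phi> w - \<phi> v) + norm (\<phi> v - \<phi> u)"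
          using norm_triangle_ineq[of "\<phi> w - \<phi> v" "\<phi> v - \<phi> u"] by simp
        ultimately show "norm (\<phi> w - \<phi> u) \<le> (K + \<epsilon>) * (w - u) + L * m u w"
          by (smt (verit) distrib_left)
      qed
    next
      case (local x)
      show ?case
      proof (cases "x \<in> N")
        case True
        then obtain d where d: "d > 0" "ball x d \<subseteq> W"
          using W by (meson open_contains_ball subsetD)
        \<comment> \<open>The whole interval lies in \<open>W\<close>, so \<open>m u v\<close> is
          its length and the term \<open>L * m u v\<close> alone pays for the increment.\<close>
        have "P u v" if uv: "u \<le> x" "x \<le> v" "v - u < d" for u v
          unfolding P_def
        proof
          assume ab: "a \<le> u \<and> v \<le> b \<and> u \<le> v"
          have "W \<inter> {u..v} = {u..v}"
            using d(2) uv by (force simp: dist_real_def subset_iff)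
          then have "m u v = v - u" using ab by (simp add: m_def)
          moreover have "norm (\<phi> v - \<phi> u) \<le> L * (v - u)"
            using lipschitz_onD[OF lip, of v u] ab by (auto simp: dist_norm)
          moreover have "0 \<le> (K + \<epsilon>) * (v - u)"
            using ab \<open>0 \<le> K\<close> \<open>\<epsilon> > 0\<close> by simp
          ultimately show "norm (\<phi> v - \<phi> u) \<le> (K + \<epsilon>) * (v - u) + L * m u v" by simp
        qed
        then show ?thesis using d(1) by blast
      next
        case False
        then obtain D where D: "(\<phi> has_vector_derivative D) (at x)" "norm D \<le> K"
          using good[of x] local by auto
        then obtain d where d: "d > 0"
          "\<And>y. norm (y - x) < d \<Longrightarrow> norm (\<phi> y - \<phi> x - (y - x) *\<^sub>R D) \<le> \<epsilon> * norm (y - x)"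
          unfolding has_vector_derivative_def has_derivative_at_alt using \<open>\<epsilon> > 0\<close> by blast
        \<comment> \<open>Differentiability compares values only with the one at \<open>x\<close>;
          an interval around \<open>x\<close> is therefore split at \<open>x\<close>.\<close>
        have near: "norm (\<phi> y - \<phi> x) \<le> (K + \<epsilon>) * \<bar>y - x\<bar>" if "\<bar>y - x\<bar> < d" for y
        proof -
          have "norm (\<phi> y - \<phi> x) \<le> norm (\<phi> y - \<phi> x - (y - x) *\<^sub>R D) + norm ((y - x) *\<^sub>R D)"
            using norm_triangle_ineq[of "\<phi> y - \<phi> x - (y - x) *\<^sub>R D" "(y - x) *\<^sub>R D"] by simp
          also have "\<dots> \<le> \<epsilon> * \<bar>y - x\<bar> + \<bar>y - x\<bar> * K"
            using d(2)[of y] that D(2) by (intro add_mono) (auto intro: mult_left_mono)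
          finally show ?thesis by (simp add: algebra_simps)
        qed
        have "P u v" if uv: "u \<le> x" "x \<le> v" "v - u < d" for u v
          unfolding P_def
        proof
          assume "a \<le> u \<and> v \<le> b \<and> u \<le> v"
          have "norm (\<phi> v - \<phi> u) \<le> norm (\<phi> v - \<phi> x) + norm (\<phi> u - \<phi> x)"
            using norm_triangle_ineq4[of "\<phi> v - \<phi> x" "\<phi> u - \<phi> x"] by simp
          also have "\<dots> \<le> (K + \<epsilon>) * \<bar>v - x\<bar> + (K + \<epsilon>) * \<bar>u - x\<bar>"
            using uv by (intro add_mono near) auto
          also have "\<dots> = (K + \<epsilon>) * (v - u)"
            using uv by (simp add: algebra_simps)
          also have "\<dots> \<le> (K + \<epsilon>) * (v - u) + L * m u v"
            using L by (simp add: m_def)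
          finally show "norm (\<phi> v - \<phi> u) \<le> (K + \<epsilon>) * (v - u) + L * m u v" .
        qed
        then show ?thesis using d(1) by blast
      qed
    qed
    then have "norm (\<phi> b - \<phi> a) \<le> (K + \<epsilon>) * (b - a) + L * m a b"
      using \<open>a \<le> b\<close> by (simp add: P_def)
    also have "\<dots> \<le> (K + \<epsilon>) * (b - a) + L * \<epsilon>"
      using mab L by (simp add: mult_left_mono)
    finally show ?thesis .
  qed
  have lim: "((\<lambda>\<epsilon>. (K + \<epsilon>) * (b - a) + L * \<epsilon>) \<longlongrightarrow> (K + 0) * (b - a) + L * 0) (at_right 0)"
    by (intro tendsto_intros)
  show ?thesis
    using tendsto_lowerbound[OF lim eventually_mono[OF eventually_at_right_less bound]] by simp
qed

section \<open>Lebesgue null sets under translation and along lines\<close>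

context
  fixes B :: "'a::real_normed_vector set"
  assumes finite_B: "finite B"
begin

interpretation product_sigma_finite "\<lambda>_::'a. lborel :: real measure"
  by standard

text \<open>A product measure is determined by its values on boxes, and the preimage of a box is the
  box with translated sides. One-dimensional translation invariance then applies to each
  factor.\<close>

lemma distr_PiM_lborel_plus:
  "distr (\<Pi>\<^sub>M b\<in>B. lborel) (\<Pi>\<^sub>M b\<in>B. lborel) (\<lambda>c. \<lambda>b\<in>B. d b + c b) = (\<Pi>\<^sub>M b\<in>B. (lborel :: real measure))"
  (is "distr ?M ?M ?\<tau> = ?M")
proof (rule PiM_eqI[OF finite_B])
  fix A :: "'a \<Rightarrow> real set" assume A: "\<And>b. b \<in> B \<Longrightarrow> A b \<in> sets lborel"
  have \<tau>: "?\<tau> \<in> measurable ?M ?M"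
    by measurable
  define A' where "A' b = (\<lambda>s. d b + s) -` A b" for b
  have A': "A' b \<in> sets lborel" "emeasure lborel (A' b) = emeasure lborel (A b)" if "b \<in> B" for b
  proof -
    have "(+) (d b) \<in> measurable lborel lborel" by simp
    from measurable_sets[OF this A[OF that]] show "A' b \<in> sets lborel"
      by (simp add: A'_def)
    have "emeasure lborel (A b) = emeasure (distr lborel borel ((+) (d b))) (A b)"
      by (simp add: lborel_distr_plus)
    also have "\<dots> = emeasure lborel (A' b)"
      using A[OF that] by (subst emeasure_distr) (auto simp: A'_def)
    finally show "emeasure lborel (A' b) = emeasure lborel (A b)" by simp
  qed
  have "emeasure (distr ?M ?M ?\<tau>) (Pi\<^sub>E B A) = emeasure ?M (?\<tau> -` Pi\<^sub>E B A \<inter> space ?M)"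
    using A finite_B by (intro emeasure_distr \<tau> sets_PiM_I_finite) auto
  also have "?\<tau> -` Pi\<^sub>E B A \<inter> space ?M = Pi\<^sub>E B A'"
    by (auto simp: space_PiM A'_def PiE_def Pi_def extensional_def)
  also have "emeasure ?M (Pi\<^sub>E B A') = (\<Prod>b\<in>B. emeasure lborel (A b))"
    using A' by (subst emeasure_PiM[OF finite_B]) auto
  finally show "emeasure (distr ?M ?M ?\<tau>) (Pi\<^sub>E B A) = (\<Prod>b\<in>B. emeasure lborel (A b))" .
qed simp

text \<open>For each fixed \<open>t\<close> the map in \<open>c\<close> is a translation, so almost
  every \<open>c\<close> avoids the exceptional set; Fubini exchanges the two quantifiers.\<close>

lemma AE_PiM_lborel_lines:
  assumes "AE c in (\<Pi>\<^sub>M b\<in>B. (lborel :: real measure)). P c"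
  shows "AE c in (\<Pi>\<^sub>M b\<in>B. (lborel :: real measure)).
    AE t in lborel. P (\<lambda>b\<in>B. (\<xi> b + t * d b) + c b)"
proof -
  let ?M = "\<Pi>\<^sub>M b\<in>B. (lborel :: real measure)"
  interpret M: sigma_finite_measure ?M by (rule sigma_finite[OF finite_B])
  interpret pair_sigma_finite ?M "lborel :: real measure" ..
  \<comment> \<open>\<open>P\<close> need not be measurable, so Fubini is applied to a measurable
    null set containing the exceptions.\<close>
  obtain N where N: "N \<in> null_sets ?M" and good: "\<And>c. c \<in> space ?M \<Longrightarrow> c \<notin> N \<Longrightarrow> P c"
    by (rule AE_E3[OF assms]) auto
  note [measurable] = null_setsD2[OF N]
  have "AE c in ?M. (\<lambda>b\<in>B. (\<xi> b + t * d b) + c b) \<notin> N" for t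
  proof -
    have "AE c in distr ?M ?M (\<lambda>c. \<lambda>b\<in>B. (\<xi> b + t * d b) + c b). c \<notin> N"
      unfolding distr_PiM_lborel_plus by (rule AE_not_in[OF N])
    then show ?thesis by (subst (asm) AE_distr_iff) measurable
  qed
  then have "AE t in lborel. AE c in ?M. (\<lambda>b\<in>B. (\<xi> b + t * d b) + c b) \<notin> N" by simp
  then have "AE c in ?M. AE t in lborel. (\<lambda>b\<in>B. (\<xi> b + t * d b) + c b) \<notin> N"
    by (subst AE_commute) measurable
  then show ?thesis
    by (elim eventually_mono) (auto intro!: good simp: space_PiM)
qed

text \<open>The box with all sides \<open>{0<..<e}\<close> has positive measure, so it cannot lie
  inside a null set. For empty \<open>B\<close> its measure is the empty product 1.\<close>

lemma AE_PiM_lborel_small: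
  assumes "AE c in (\<Pi>\<^sub>M b\<in>B. (lborel :: real measure)). P c" and "0 < e"
  shows "\<exists>c. (\<forall>b\<in>B. \<bar>c b\<bar> < e) \<and> P c"
proof (rule ccontr)
  let ?M = "\<Pi>\<^sub>M b\<in>B. (lborel :: real measure)"
  assume *: "\<not> ?thesis"
  obtain N where N: "N \<in> null_sets ?M" and good: "\<And>c. c \<in> space ?M \<Longrightarrow> c \<notin> N \<Longrightarrow> P c"
    by (rule AE_E3[OF assms(1)]) auto
  have "Pi\<^sub>E B (\<lambda>_. {0<..<e}) \<subseteq> N"
  proof
    fix c assume c: "c \<in> Pi\<^sub>E B (\<lambda>_. {0<..<e})"
    then have "\<forall>b\<in>B. \<bar>c b\<bar> < e" by (auto simp: PiE_def Pi_def)
    with * c good[of c] show "c \<in> N" by (auto simp: space_PiM)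
  qed
  then have "emeasure ?M (Pi\<^sub>E B (\<lambda>_. {0<..<e})) = 0"
    using N by (metis emeasure_mono le_zero_eq null_setsD1 null_setsD2)
  moreover have "emeasure ?M (Pi\<^sub>E B (\<lambda>_. {0<..<e})) = (\<Prod>b\<in>B. ennreal e)"
    using \<open>0 < e\<close> by (subst emeasure_PiM[OF finite_B]) auto
  ultimately show False using \<open>0 < e\<close> finite_B by (simp add: prod_zero_iff)
qed

end

lemma almost_everywhere_mono:
  assumes "almost_everywhere P" and "\<And>y. P y \<Longrightarrow> Q y"
  shows "almost_everywhere Q"
proof -
  obtain B where "finite B" "independent B" "span B = UNIV"
    and ae: "AE c in (\<Pi>\<^sub>M b\<in>B. (lborel :: real measure)). P (\<Sum>b\<in>B. c b *\<^sub>R b)"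
    using assms(1) unfolding almost_everywhere_def by blast
  moreover have "AE c in (\<Pi>\<^sub>M b\<in>B. (lborel :: real measure)). Q (\<Sum>b\<in>B. c b *\<^sub>R b)"
    using ae by (rule eventually_mono) (rule assms(2))
  ultimately show ?thesis unfolding almost_everywhere_def by blast
qed

text \<open>A given line may lie entirely in the exceptional set; this supplies an arbitrarily close
  parallel line that meets it only in a null set of parameters.\<close>

lemma almost_everywhere_line:
  fixes P :: "'a::real_normed_vector \<Rightarrow> bool"
  assumes "almost_everywhere P" and "0 < e"
  obtains c where "norm c < e" and "AE t in lborel. P (x + t *\<^sub>R v + c)"
proof -
  obtain B where B: "finite B" "span B = (UNIV :: 'a set)"
    and ae: "AE c in (\<Pi>\<^sub>M b\<in>B. (lborel :: real measure)). P (\<Sum>b\<in>B. c b *\<^sub>R b)"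
    using assms(1) unfolding almost_everywhere_def by blast
  have "\<exists>\<xi>. y = (\<Sum>b\<in>B. \<xi> b *\<^sub>R b)" for y
    using span_finite[OF B(1)] B(2) by (metis (no_types, lifting) UNIV_I imageE)
  then obtain \<xi> d where \<xi>: "x = (\<Sum>b\<in>B. \<xi> b *\<^sub>R b)" and d: "v = (\<Sum>b\<in>B. d b *\<^sub>R b)"
    by metis
  \<comment> \<open>Coordinates below \<open>e / S\<close> give norm at most
    \<open>e / S * (S - 1) < e\<close>; the summand 1 keeps \<open>S\<close> positive and the
    inequality strict.\<close>
  define S where "S = 1 + (\<Sum>b\<in>B. norm b)"
  have S: "S > 0" unfolding S_def by (intro add_pos_nonneg sum_nonneg) auto
  obtain c where c: "\<And>b. b \<in> B \<Longrightarrow> \<bar>c b\<bar> < e / S"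
    and P: "AE t in lborel. P (\<Sum>b\<in>B. (\<lambda>b\<in>B. (\<xi> b + t * d b) + c b) b *\<^sub>R b)"
    using AE_PiM_lborel_small[OF B(1) AE_PiM_lborel_lines[OF B(1) ae], of "e / S" \<xi> d]
      \<open>0 < e\<close> S by auto
  show thesis
  proof
    have "norm (\<Sum>b\<in>B. c b *\<^sub>R b) \<le> (\<Sum>b\<in>B. e / S * norm b)"
      using c by (intro sum_norm_le) (simp add: mult_right_mono less_imp_le del: times_divide_eq_left)
    also have "\<dots> = e / S * (S - 1)" by (simp add: S_def sum_distrib_left)
    also have "\<dots> < e" using S \<open>0 < e\<close> by (simp add: field_simps)
    finally show "norm (\<Sum>b\<in>B. c b *\<^sub>R b) < e" .
    have "(\<Sum>b\<in>B. (\<lambda>b\<in>B. (\<xi> b + t * d b) + c b) b *\<^sub>R b) = x + t *\<^sub>R v + (\<Sum>b\<in>B. c b *\<^sub>R b)" for t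
      unfolding \<xi> d scaleR_sum_right sum.distrib[symmetric]
      by (intro sum.cong) (auto simp: algebra_simps)
    then show "AE t in lborel. P (x + t *\<^sub>R v + (\<Sum>b\<in>B. c b *\<^sub>R b))"
      using P by simp
  qed
qed

section \<open>From an a.e. derivative bound to a Lipschitz constant\<close>

text \<open>The constant \<open>L\<close> enters only qualitatively: it excludes Cantor-type growth
  on the null set and bounds the cost of moving both endpoints by \<open>c\<close>. That cost
  vanishes with \<open>c\<close>, which leaves \<open>K\<close>.\<close>

lemma lipschitz_on_of_almost_everywhere_derivative:
  fixes G :: "'a::real_normed_vector \<Rightarrow> 'b::real_normed_vector"
  assumes "open U" "convex U" and lip: "L-lipschitz_on U G" and "0 \<le> K"
    and ae: "almost_everywhere (\<lambda>y. y \<in> U \<longrightarrow>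
      (\<exists>D. (G has_derivative D) (at y) \<and> (\<forall>h. norm (D h) \<le> K * norm h)))"
  shows "K-lipschitz_on U G"
proof (rule lipschitz_onI[OF _ \<open>0 \<le> K\<close>])
  fix x y assume xy: "x \<in> U" "y \<in> U"
  have L: "0 \<le> L" using lip by (rule lipschitz_on_nonneg)
  obtain r1 r2 where r12: "r1 > 0" "ball x r1 \<subseteq> U" "r2 > 0" "ball y r2 \<subseteq> U"
    using xy \<open>open U\<close> by (meson open_contains_ball)
  define r where "r = min r1 r2"
  have r: "r > 0" "\<And>c. norm c < r \<Longrightarrow> x + c \<in> U" "\<And>c. norm c < r \<Longrightarrow> y + c \<in> U"
    using r12 by (auto simp: r_def subset_iff dist_norm)
  define v where "v = y - x"
  have "norm (G y - G x) \<le> K * norm v + \<epsilon>" if "\<epsilon> > 0" for \<epsilon>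
  proof -
    \<comment> \<open>Moving two endpoints costs at most \<open>2 * L * e\<close>. The
      \<open>+ 1\<close> covers \<open>L = 0\<close>, and \<open>r\<close> keeps the moved endpoints
      in \<open>U\<close>, hence by convexity the moved segment.\<close>
    define e where "e = min r (\<epsilon> / (2 * L + 1))"
    have e: "0 < e" "2 * L * e \<le> \<epsilon>"
    proof -
      show "0 < e" using r L \<open>\<epsilon> > 0\<close> by (simp add: e_def)
      have "2 * L * e \<le> (2 * L + 1) * (\<epsilon> / (2 * L + 1))"
        using L \<open>\<epsilon> > 0\<close> \<open>0 < e\<close> by (intro mult_mono) (auto simp: e_def)
      then show "2 * L * e \<le> \<epsilon>" using L by simp
    qed
    obtain c where c: "norm c < e" and good: "AE t in lborel. x + t *\<^sub>R v + c \<in> U \<longrightarrow>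
        (\<exists>D. (G has_derivative D) (at (x + t *\<^sub>R v + c)) \<and> (\<forall>h. norm (D h) \<le> K * norm h))"
      using almost_everywhere_line[OF ae \<open>0 < e\<close>] by blast
    have xyc: "x + c \<in> U" "y + c \<in> U" using r c by (auto simp: e_def)
    have in_U: "x + t *\<^sub>R v + c \<in> U" if "t \<in> {0..1}" for t
    proof -
      have "(1 - t) *\<^sub>R (x + c) + t *\<^sub>R (y + c) \<in> U"
        using that by (intro convexD[OF \<open>convex U\<close>] xyc) auto
      then show ?thesis by (simp add: v_def algebra_simps)
    qed
    let ?\<phi> = "\<lambda>t. G (x + t *\<^sub>R v + c)"
    have "(L * norm v)-lipschitz_on {0..1} ?\<phi>"
    proof (rule lipschitz_onI)
      fix s t :: real assume "s \<in> {0..1}" "t \<in> {0..1}"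
      then have "dist (?\<phi> s) (?\<phi> t) \<le> L * dist (x + s *\<^sub>R v + c) (x + t *\<^sub>R v + c)"
        by (intro lipschitz_onD[OF lip] in_U)
      also have "dist (x + s *\<^sub>R v + c) (x + t *\<^sub>R v + c) = dist s t * norm v"
        by (simp add: dist_norm flip: scaleR_diff_left)
      finally show "dist (?\<phi> s) (?\<phi> t) \<le> L * norm v * dist s t" by (simp add: mult_ac)
    qed (use L in simp)
    moreover have "AE t in lborel. t \<in> {0..1} \<longrightarrow>
      (\<exists>D. (?\<phi> has_vector_derivative D) (at t) \<and> norm D \<le> K * norm v)"
      using good
    proof (elim eventually_mono, intro impI)
      fix t :: real
      assume t: "x + t *\<^sub>R v + c \<in> U \<longrightarrow>
        (\<exists>D. (G has_derivative D) (at (x + t *\<^sub>R v + c)) \<and> (\<forall>h. norm (D h) \<le> K * norm h))"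
        "t \<in> {0..1}"
      then obtain D where D: "(G has_derivative D) (at (x + t *\<^sub>R v + c))"
        "norm (D v) \<le> K * norm v"
        using in_U by blast
      have "((\<lambda>t. x + t *\<^sub>R v + c) has_vector_derivative v) (at t)"
        by (auto intro!: derivative_eq_intros simp: has_vector_derivative_def)
      then have "(?\<phi> has_vector_derivative D v) (at t)"
        using vector_derivative_diff_chain_within[of "\<lambda>t. x + t *\<^sub>R v + c" v t UNIV G D]
          has_derivative_at_withinI[OF D(1)] by (simp add: o_def)
      then show "\<exists>D. (?\<phi> has_vector_derivative D) (at t) \<and> norm D \<le> K * norm v"
        using D(2) by blast
    qed
    ultimately have "norm (?\<phi> 1 - ?\<phi> 0) \<le> K * norm v * (1 - 0)"
      using \<open>0 \<le> K\<close> by (intro norm_diff_le_of_AE_derivative) auto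
    then have "dist (G (y + c)) (G (x + c)) \<le> K * norm v"
      by (simp add: dist_norm v_def)
    moreover have "dist (G (y + c)) (G y) \<le> L * norm c" "dist (G (x + c)) (G x) \<le> L * norm c"
      using lipschitz_onD[OF lip xyc(2) xy(2)] lipschitz_onD[OF lip xyc(1) xy(1)]
      by (simp_all add: dist_norm)
    moreover have "L * norm c \<le> L * e" using c L by (intro mult_left_mono) auto
    moreover have "dist (G y) (G x)
        \<le> dist (G (y + c)) (G y) + dist (G (y + c)) (G (x + c)) + dist (G (x + c)) (G x)"
      using dist_triangle[of "G y" "G x" "G (y + c)"] dist_triangle[of "G (y + c)" "G x" "G (x + c)"]
      by (simp add: dist_commute)
    ultimately show ?thesis using e(2) by (simp add: dist_norm)
  qed
  then have "norm (G y - G x) \<le> K * norm v" by (rule field_le_epsilon)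
  then show "dist (G x) (G y) \<le> K * dist x y"
    by (simp add: v_def dist_norm norm_minus_commute)
qed

section \<open>The gradient and its local Lipschitz constant\<close>

lemma has_derivative_grad:
  assumes "f differentiable (at x)"
  shows "(f has_derivative blinfun_apply (grad f x)) (at x)"
proof -
  have D: "(f has_derivative frechet_derivative f (at x)) (at x)"
    using assms frechet_derivative_works by blast
  then show ?thesis
    unfolding grad_def by (simp add: bounded_linear_Blinfun_apply has_derivative_bounded_linear)
qed

text \<open>The gradient is continuous, so the strict bound by \<open>M\<close> survives on a ball.
  There monotonicity of \<l> turns the a.e. Hessian bound into the constant \<open>\<l> M\<close>,
  and a ball is convex.\<close>

lemma ell_smooth_imp_locally_lipschitz:
  assumes smooth: "ell_smooth \<l> X f" and mono: "mono_on {0..} \<l>" and "open X"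
    and pos: "\<And>t. t \<ge> 0 \<Longrightarrow> \<l> t > 0"
    and z: "z \<in> X" "norm (grad f z) < M"
  obtains e where "e > 0" "ball z e \<subseteq> X" "(\<l> M)-lipschitz_on (ball z e) (grad f)"
proof -
  obtain e0 L where e0: "e0 > 0" and L: "L-lipschitz_on (ball z e0 \<inter> X) (grad f)"
    using smooth z unfolding ell_smooth_def by blast
  have "open (ball z e0 \<inter> X)" using \<open>open X\<close> by auto
  then have "open ((ball z e0 \<inter> X) \<inter> grad f -` ball 0 M)"
    using lipschitz_on_continuous_on[OF L] by (intro continuous_open_preimage) auto
  moreover have "z \<in> (ball z e0 \<inter> X) \<inter> grad f -` ball 0 M"
    using z e0 by simp
  ultimately obtain e where e: "e > 0" "ball z e \<subseteq> (ball z e0 \<inter> X) \<inter> grad f -` ball 0 M"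
    by (rule openE)
  have M: "0 \<le> M" using z(2) norm_ge_zero[of "grad f z"] by linarith
  have "(\<l> M)-lipschitz_on (ball z e) (grad f)"
  proof (rule lipschitz_on_of_almost_everywhere_derivative)
    show "L-lipschitz_on (ball z e) (grad f)" using e(2) by (intro lipschitz_on_subset[OF L]) auto
    show "0 \<le> \<l> M" using pos[OF M] by simp
    have step: "\<exists>D. (grad f has_derivative D) (at y) \<and> (\<forall>h. norm (D h) \<le> \<l> M * norm h)"
      if "y \<in> X \<longrightarrow> grad f differentiable (at y) \<and>
           (\<forall>h. dual_norm (hess f y h) \<le> \<l> (dual_norm (grad f y)) * norm h)"
        and "y \<in> ball z e" for y
    proof (intro exI conjI allI)
      have y: "y \<in> X" "norm (grad f y) \<le> M" using that(2) e(2) by auto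
      show "(grad f has_derivative hess f y) (at y)"
        unfolding hess_def using that(1) y(1) frechet_derivative_works by blast
      fix h
      have "norm (hess f y h) \<le> \<l> (norm (grad f y)) * norm h"
        using that(1) y(1) by (simp add: dual_norm_eq_norm)
      also have "\<dots> \<le> \<l> M * norm h"
        using y(2) M by (intro mult_right_mono mono_onD[OF mono]) auto
      finally show "norm (hess f y h) \<le> \<l> M * norm h" .
    qed
    have ae: "almost_everywhere (\<lambda>y. y \<in> X \<longrightarrow> grad f differentiable (at y) \<and>
           (\<forall>h. dual_norm (hess f y h) \<le> \<l> (dual_norm (grad f y)) * norm h))"
      using smooth unfolding ell_smooth_def by blast
    show "almost_everywhere (\<lambda>y. y \<in> ball z e \<longrightarrow>
      (\<exists>D. (grad f has_derivative D) (at y) \<and> (\<forall>h. norm (D h) \<le> \<l> M * norm h)))"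
      by (rule almost_everywhere_mono[OF ae]) (use step in blast)
  qed auto
  with e show thesis using that by auto
qed

section \<open>Descent by continuation along a segment\<close>

text \<open>\<open>T\<close> stays strictly below \<open>a / L\<close> so that
  \<open>L * T < a \<le> norm (grad f x)\<close>, which keeps the gradient norm strictly below
  \<open>2 * norm (grad f x)\<close>, as the local Lipschitz bound requires.\<close>

lemma ell_smooth_descent:
  fixes X :: "'a::real_normed_vector set"
  assumes mono: "mono_on {0..} \<l>" and pos: "\<And>t. t \<ge> 0 \<Longrightarrow> \<l> t > 0"
    and "open X" and diff: "f differentiable_on X"
    and closed: "\<And>a. closed {y \<in> X. f y \<le> a}"
    and smooth: "ell_smooth \<l> X f" and "x \<in> X"
    and h: "norm h \<le> 1" and a: "a = blinfun_apply (grad f x) h"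
    and L: "L = \<l> (2 * norm (grad f x))" and T: "0 \<le> T" "T < a / L"
  shows "x - T *\<^sub>R h \<in> X \<and> f (x - T *\<^sub>R h) \<le> f x - a * T + L * T\<^sup>2 / 2"
proof -
  define g where "g = grad f x"
  define y where "y s = x - s *\<^sub>R h" for s
  have Lpos: "L > 0" unfolding L by (rule pos) simp
  then have "L * T < a" using T(2) by (simp add: field_simps)
  have "a \<le> norm g"
    using norm_blinfun[of g h] h mult_left_le[of "norm h" "norm g"] by (simp add: a g_def)
  have y0: "y 0 = x" by (simp add: y_def)
  have dist_y: "dist (y s) (y t) \<le> \<bar>s - t\<bar>" for s t
  proof -
    have "dist (y s) (y t) = \<bar>s - t\<bar> * norm h"
      by (simp add: y_def dist_norm abs_minus_commute flip: scaleR_diff_left)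
    then show ?thesis using h by (simp add: mult_left_le)
  qed
  have cont_y: "continuous_on S y" for S
    unfolding y_def by (intro continuous_intros)
  \<comment> \<open>Quantifying over all earlier \<open>s\<close> makes \<open>Q\<close> inherited
    by smaller times, as the supremum argument below requires.\<close>
  define Q where "Q t \<longleftrightarrow> (\<forall>s\<in>{0..t}. y s \<in> X \<and> norm (grad f (y s) - g) \<le> L * s)" for t
  have descent: "f (y t) \<le> f x - a * t + L * t\<^sup>2 / 2" if t: "0 \<le> t" "Q t" for t
  proof -
    \<comment> \<open>The derivative of this function is \<open>a - grad f (y s) h - L * s\<close>,
      which is nonpositive because the gradient has moved by at most \<open>L * s\<close> and
      \<open>norm h \<le> 1\<close>.\<close>
    let ?\<psi> = "\<lambda>s. f (y s) + a * s - L * s\<^sup>2 / 2"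
    have "?\<psi> t \<le> ?\<psi> 0"
    proof (rule DERIV_nonpos_imp_nonincreasing[OF t(1)])
      fix s assume s: "0 \<le> s" "s \<le> t"
      with t(2) have ys: "y s \<in> X" "norm (grad f (y s) - g) \<le> L * s" by (auto simp: Q_def)
      have "f differentiable (at (y s))"
        using diff ys(1) \<open>open X\<close> by (simp add: differentiable_on_eq_differentiable_at)
      note D = has_derivative_grad[OF this]
      have "(y has_vector_derivative - h) (at s)"
        unfolding y_def by (auto intro!: derivative_eq_intros simp: has_vector_derivative_def)
      then have "((\<lambda>s. f (y s)) has_vector_derivative grad f (y s) (- h)) (at s)"
        using vector_derivative_diff_chain_within[of y "- h" s UNIV f "grad f (y s)"]
          has_derivative_at_withinI[OF D] by (simp add: o_def)
      then have "((\<lambda>s. f (y s)) has_real_derivative - grad f (y s) h) (at s)"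
        by (simp add: has_real_derivative_iff_has_vector_derivative blinfun.minus_right)
      then have "(?\<psi> has_real_derivative - grad f (y s) h + a - L * s) (at s)"
        by (auto intro!: derivative_eq_intros)
      moreover have "- grad f (y s) h + a - L * s \<le> 0"
      proof -
        have "a - grad f (y s) h = - ((grad f (y s) - g) h)"
          by (simp add: a g_def blinfun.diff_left)
        also have "\<dots> \<le> norm (grad f (y s) - g) * norm h"
          using norm_blinfun[of "grad f (y s) - g" h] by simp
        also have "\<dots> \<le> norm (grad f (y s) - g)" using h by (simp add: mult_left_le)
        finally show ?thesis using ys(2) by simp
      qed
      ultimately show "\<exists>D. (?\<psi> has_real_derivative D) (at s) \<and> D \<le> 0" by blast
    qed
    then show ?thesis by (simp add: y0)
  qed
  \<comment> \<open>Since \<open>L * t \<le> a\<close>, the quadratic term is at most half of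
    \<open>a * t\<close>, so the walk stays in the sublevel set of \<open>f x\<close>.\<close>
  have below: "f (y t) \<le> f x" if t: "0 \<le> t" "t \<le> T" "Q t" for t
  proof -
    have "L * t \<le> L * T" using t(2) Lpos by simp
    then have "L * t \<le> a" using \<open>L * T < a\<close> by simp
    then have "L * t * t \<le> a * t" using t(1) by (rule mult_right_mono)
    moreover have "0 \<le> a * t" using t(1) \<open>L * t \<le> a\<close> Lpos by (smt (verit) mult_nonneg_nonneg)
    ultimately show ?thesis using descent[OF t(1,3)] by (simp add: power2_eq_square)
  qed
  have "Q T"
  proof -
    \<comment> \<open>Continuation: \<open>Q\<close> passes to the supremum \<sigma> by closedness,
      and beyond it by the local Lipschitz bound unless \<open>\<sigma> = T\<close>.\<close>
    define A where "A = {t \<in> {0..T}. Q t}"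
    define \<sigma> where "\<sigma> = Sup A"
    have "Q 0" using \<open>x \<in> X\<close> by (simp add: Q_def y0 g_def)
    then have "0 \<in> A" using T by (simp add: A_def)
    have bdd: "bdd_above A" by (rule bdd_aboveI[of _ T]) (simp add: A_def)
    have \<sigma>: "0 \<le> \<sigma>" "\<sigma> \<le> T"
      unfolding \<sigma>_def using \<open>0 \<in> A\<close> bdd by (auto intro!: cSup_upper cSup_least simp: A_def)
    have Q_less: "Q s" if "s < \<sigma>" for s
    proof -
      obtain t where "t \<in> A" "s < t"
        using \<open>s < \<sigma>\<close> less_cSup_iff[OF _ bdd] \<open>0 \<in> A\<close> unfolding \<sigma>_def by blast
      then show ?thesis by (auto simp: A_def Q_def)
    qed
    have "Q \<sigma>"
    proof (cases "\<sigma> = 0")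
      case True
      then show ?thesis using \<open>Q 0\<close> by simp
    next
      case False
      with \<sigma> have "\<sigma> > 0" by simp
      have *: "eventually (\<lambda>s. s \<in> {0<..<\<sigma>}) (at_left \<sigma>)"
        using \<open>\<sigma> > 0\<close> by (rule eventually_at_left_real)
      have lim_y: "(y \<longlongrightarrow> y \<sigma>) (at_left \<sigma>)"
        unfolding y_def by (intro tendsto_intros)
      \<comment> \<open>Here closedness of the sublevel set prevents the walk from reaching the
        boundary of the open domain.\<close>
      have "y \<sigma> \<in> {z \<in> X. f z \<le> f x}"
      proof (rule Lim_in_closed_set[OF closed _ _ lim_y])
        show "eventually (\<lambda>s. y s \<in> {z \<in> X. f z \<le> f x}) (at_left \<sigma>)"
          using * by (rule eventually_mono) (use \<sigma> Q_less below in \<open>force simp: Q_def\<close>)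
      qed simp
      then have "y \<sigma> \<in> X" by simp
      then obtain e K where "e > 0" "K-lipschitz_on (ball (y \<sigma>) e \<inter> X) (grad f)"
        using smooth unfolding ell_smooth_def by blast
      then have "continuous_on (ball (y \<sigma>) e \<inter> X) (grad f)" by (intro lipschitz_on_continuous_on)
      then have "isCont (grad f) (y \<sigma>)"
        using \<open>open X\<close> \<open>y \<sigma> \<in> X\<close> \<open>e > 0\<close> by (simp add: continuous_on_eq_continuous_at open_Int)
      then have "((\<lambda>s. grad f (y s)) \<longlongrightarrow> grad f (y \<sigma>)) (at_left \<sigma>)"
        using lim_y by (rule isCont_tendsto_compose)
      then have "((\<lambda>s. L * s - norm (grad f (y s) - g)) \<longlongrightarrow> L * \<sigma> - norm (grad f (y \<sigma>) - g)) (at_left \<sigma>)"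
        by (intro tendsto_intros)
      then have "0 \<le> L * \<sigma> - norm (grad f (y \<sigma>) - g)"
      proof (rule tendsto_lowerbound)
        show "\<forall>\<^sub>F s in at_left \<sigma>. 0 \<le> L * s - norm (grad f (y s) - g)"
          using * by (rule eventually_mono) (use Q_less in \<open>force simp: Q_def\<close>)
      qed simp
      moreover have "y s \<in> X \<and> norm (grad f (y s) - g) \<le> L * s" if "0 \<le> s" "s < \<sigma>" for s
        using Q_less[OF that(2)] that(1) by (simp add: Q_def)
      ultimately show ?thesis
        using \<open>y \<sigma> \<in> X\<close> unfolding Q_def by (metis atLeastAtMost_iff diff_ge_0_iff_ge order_le_less)
    qed
    show ?thesis
    proof (cases "\<sigma> = T")
      case True
      with \<open>Q \<sigma>\<close> show ?thesis by simp
    next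
      case False
      with \<sigma> have "\<sigma> < T" by simp
      have y\<sigma>: "y \<sigma> \<in> X" "norm (grad f (y \<sigma>) - g) \<le> L * \<sigma>"
        using \<open>Q \<sigma>\<close> \<sigma> by (auto simp: Q_def)
      have "L * \<sigma> < L * T" using \<open>\<sigma> < T\<close> Lpos by simp
      then have "L * \<sigma> < a" using \<open>L * T < a\<close> by simp
      then have "norm (grad f (y \<sigma>)) < 2 * norm g"
        using norm_triangle_ineq[of "grad f (y \<sigma>) - g" g] y\<sigma>(2) \<open>a \<le> norm g\<close> by simp
      then obtain e where e: "e > 0" "ball (y \<sigma>) e \<subseteq> X" "L-lipschitz_on (ball (y \<sigma>) e) (grad f)"
        using ell_smooth_imp_locally_lipschitz[OF smooth mono \<open>open X\<close> pos y\<sigma>(1)]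
        unfolding L g_def by blast
      \<comment> \<open>Half the radius keeps the walk inside the ball, as its speed is at most 1.
        Then \<open>Q \<tau>\<close> with \<open>\<tau> > \<sigma>\<close> contradicts the choice of
        \<sigma>.\<close>
      define \<tau> where "\<tau> = min T (\<sigma> + e / 2)"
      have \<tau>: "\<sigma> < \<tau>" "\<tau> \<le> T" "\<tau> < \<sigma> + e" using \<open>\<sigma> < T\<close> e(1) by (auto simp: \<tau>_def)
      have "Q \<tau>"
        unfolding Q_def
      proof
        fix s assume s: "s \<in> {0..\<tau>}"
        show "y s \<in> X \<and> norm (grad f (y s) - g) \<le> L * s"
        proof (cases "s \<le> \<sigma>")
          case True
          then show ?thesis using \<open>Q \<sigma>\<close> s by (simp add: Q_def)
        next
          case False
          then have ys: "y s \<in> ball (y \<sigma>) e"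
            using dist_y[of \<sigma> s] s \<tau> by simp
          have "norm (grad f (y s) - grad f (y \<sigma>)) \<le> L * dist (y s) (y \<sigma>)"
            using lipschitz_onD[OF e(3) ys, of "y \<sigma>"] e(1) by (simp add: dist_norm)
          also have "\<dots> \<le> L * (s - \<sigma>)"
            using dist_y[of s \<sigma>] False Lpos by (intro mult_left_mono) auto
          finally have "norm (grad f (y s) - grad f (y \<sigma>)) \<le> L * (s - \<sigma>)" .
          \<comment> \<open>The bounds \<open>L * \<sigma>\<close> and
            \<open>L * (s - \<sigma>)\<close> add up to \<open>L * s\<close>, so the constant does
            not deteriorate.\<close>
          then have "norm (grad f (y s) - g) \<le> L * s"
            using norm_triangle_ineq[of "grad f (y s) - grad f (y \<sigma>)" "grad f (y \<sigma>) - g"] y\<sigma>(2)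
            by (simp add: right_diff_distrib)
          then show ?thesis using ys e(2) by blast
        qed
      qed
      then have "\<tau> \<in> A" using \<tau> \<sigma> by (simp add: A_def)
      then have "\<tau> \<le> \<sigma>" unfolding \<sigma>_def using bdd by (rule cSup_upper)
      with \<tau> show ?thesis by simp
    qed
  qed
  then show ?thesis using descent[OF T(1)] T(1) by (auto simp: Q_def y_def)
qed

section \<open>The gradient bound from minimality\<close>

theorem lemma3p4:
  fixes X :: "'a::banach set"
    and f :: "'a \<Rightarrow> real"
    and \<l> :: "real \<Rightarrow> real"
    and x_star x :: 'a
  assumes "finite_dimensional TYPE('a)"
    and "mono_on {0..} \<l>" and "continuous_on {0..} \<l>" and "\<And>t. t \<ge> 0 \<Longrightarrow> \<l> t > 0"
    and "open X"
    and "f differentiable_on X"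
    and "\<And>a. closed {y \<in> X. f y \<le> a}"
    and "ell_smooth \<l> X f"
    and "is_arg_min f (\<lambda>y. y \<in> X) x_star"
    and "x \<in> X"
  shows "(dual_norm (grad f x))\<^sup>2 \<le> 2 * \<l> (2 * dual_norm (grad f x)) * (f x - f x_star)"
proof -
  define L where "L = \<l> (2 * norm (grad f x))"
  have L: "L > 0" unfolding L_def by (rule assms(4)) simp
  have min: "f x_star \<le> f z" if "z \<in> X" for z
    using assms(9) that by (auto simp: is_arg_min_def not_less)
  \<comment> \<open>Taking the root makes the claim linear in the gradient: it suffices to bound its
    value at each \<open>h\<close> in the unit ball, and no maximising \<open>h\<close> is
    needed.\<close>
  define R where "R = sqrt (2 * L * (f x - f x_star))"
  have R: "0 \<le> R" using L min[OF \<open>x \<in> X\<close>] by (simp add: R_def)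
  have "blinfun_apply (grad f x) h \<le> R" if "norm h \<le> 1" for h
  proof (cases "blinfun_apply (grad f x) h \<le> 0")
    case True
    with R show ?thesis by linarith
  next
    case False
    define a where "a = blinfun_apply (grad f x) h"
    have a: "a > 0" using False by (simp add: a_def)
    have "f x_star \<le> f x - a * t + L * t\<^sup>2 / 2" if "t \<in> {0<..<a / L}" for t
    proof -
      have "x - t *\<^sub>R h \<in> X \<and> f (x - t *\<^sub>R h) \<le> f x - a * t + L * t\<^sup>2 / 2"
        using that by (intro ell_smooth_descent[OF assms(2,4,5,6,7,8,10) \<open>norm h \<le> 1\<close> a_def L_def])
          auto
      then show ?thesis using min by force
    qed
    \<comment> \<open>The quadratic is smallest at \<open>t = a / L\<close>, which the descent lemma
      excludes; the value there, \<open>f x - a\<^sup>2 / (2 * L)\<close>, is reached as a left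
      limit.\<close>
    moreover have "eventually (\<lambda>t. t \<in> {0<..<a / L}) (at_left (a / L))"
      using a L by (intro eventually_at_left_real) simp
    ultimately have ev: "\<forall>\<^sub>F t in at_left (a / L). f x_star \<le> f x - a * t + L * t\<^sup>2 / 2"
      by (auto elim: eventually_mono)
    have "((\<lambda>t. f x - a * t + L * t\<^sup>2 / 2) \<longlongrightarrow> f x - a * (a / L) + L * (a / L)\<^sup>2 / 2) (at_left (a / L))"
      by (intro tendsto_intros) auto
    from tendsto_lowerbound[OF this ev]
    have "f x_star \<le> f x - a * (a / L) + L * (a / L)\<^sup>2 / 2" by simp
    then have "a\<^sup>2 \<le> 2 * L * (f x - f x_star)"
      using L by (simp add: field_simps power2_eq_square)
    then show ?thesis unfolding R_def a_def[symmetric] by (rule real_le_rsqrt)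
  qed
  then have "dual_norm (grad f x) \<le> R"
    unfolding dual_norm_def by (intro cSup_least) (auto intro: exI[of _ 0])
  then have "(dual_norm (grad f x))\<^sup>2 \<le> R\<^sup>2"
    by (intro power_mono) (simp_all add: dual_norm_eq_norm)
  also have "R\<^sup>2 = 2 * L * (f x - f x_star)"
    using L min[OF \<open>x \<in> X\<close>] by (simp add: R_def)
  finally show ?thesis by (simp add: L_def dual_norm_eq_norm)
qed

end
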